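(* Let $G$ be a finite group and $p$ be a prime such that $\gcd(p-1,|G|)=1$. Suppose $|G'|=p^2$ and $|G'\cap Z(G)|=p$, and let $s$ be given by $p^{2s}=|C_G(G'):Z(C_G(G'))|$. Then: (a) $\Pr(G)=\dfrac{2p^2-1}{p^4}$ if $C_G(G')$ is abelian, and $\Pr(G)=\dfrac{1}{p^4}\left(\dfrac{p-1}{p^{2s-1}}+p^2+p-1\right)$ otherwise; (b) $\left|\dfrac{G}{Z(G)}\right|=p^3$ if $C_G(G')$ is abelian, and $\left|\dfrac{G}{Z(G)}\right|\in\{p^{2s+2},\,p^{2s+3}\}$ otherwise. Moreover, $$\left|\frac{G}{G'\cap Z(G)}:Z\left(\frac{G}{G'\cap Z(G)}\right)\right|=\left|\frac{G}{Z(G)}:Z\left(\frac{G}{Z(G)}\right)\right|=p^2.$$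
   Context: For a finite group $G$: $\Pr(G)=|\{(x,y)\in G\times G: xy=yx\}|/|G|^2$ is the commutativity degree; $G'$ is the commutator subgroup; $Z(\cdot)$ denotes the center; $C_G(G')=\{x\in G: xh=hx\text{ for all }h\in G'\}$. The statement includes the assertion that the index $|C_G(G'):Z(C_G(G'))|$ is of the form $p^{2s}$ with $s$ a nonnegative integer. *)

theory Defs
  imports Complex_Main "HOL-Algebra.Algebra"
begin

definition centralizer :: "('a, 'b) monoid_scheme \<Rightarrow> 'a set \<Rightarrow> 'a set" where
  "centralizer G H = {x \<in> carrier G. \<forall>h\<in>H. x \<otimes>\<^bsub>G\<^esub> h = h \<otimes>\<^bsub>G\<^esub> x}"

definition group_center :: "('a, 'b) monoid_scheme \<Rightarrow> 'a set" where
  "group_center G = {z \<in> carrier G. \<forall>x\<in>carrier G. z \<otimes>\<^bsub>G\<^esub> x = x \<otimes>\<^bsub>G\<^esub> z}"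

definition commuting_prob :: "('a, 'b) monoid_scheme \<Rightarrow> real" where
  "commuting_prob G =
     real (card {(x, y). x \<in> carrier G \<and> y \<in> carrier G \<and> x \<otimes>\<^bsub>G\<^esub> y = y \<otimes>\<^bsub>G\<^esub> x})
       / (real (order G))\<^sup>2"

definition subgroup_index :: "('a, 'b) monoid_scheme \<Rightarrow> 'a set \<Rightarrow> nat" where
  "subgroup_index G H = card (rcosets\<^bsub>G\<^esub> H)"

definition commutator_centralizer :: "('a, 'b) monoid_scheme \<Rightarrow> ('a, 'b) monoid_scheme" where
  "commutator_centralizer G = G\<lparr>carrier := centralizer G (derived G (carrier G))\<rparr>"

lemma (in group) centralizer_subgroup:
  assumes "H \<subseteq> carrier G"
  shows "subgroup (centralizer G H) G"
proof (rule subgroupI)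
  show "centralizer G H \<subseteq> carrier G" "centralizer G H \<noteq> {}"
    using assms one_closed by (auto simp: centralizer_def subset_iff intro!: exI[of _ \<one>])
next
  fix a assume a: "a \<in> centralizer G H"
  have "inv a \<otimes> h = h \<otimes> inv a" if h: "h \<in> H" for h
  proof -
    have c: "a \<in> carrier G" "h \<in> carrier G" "a \<otimes> h = h \<otimes> a"
      using a h assms by (auto simp: centralizer_def)
    have "inv a \<otimes> h = inv a \<otimes> (h \<otimes> a) \<otimes> inv a"
      using c(1,2) by (simp add: m_assoc)
    also have "\<dots> = h \<otimes> inv a"
      using c by (metis inv_closed m_assoc m_closed inv_solve_left)
    finally show ?thesis .
  qed
  then show "inv a \<in> centralizer G H" using a by (simp add: centralizer_def)
next
  fix a b assume ab: "a \<in> centralizer G H" "b \<in> centralizer G H"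
  have "a \<otimes> b \<otimes> h = h \<otimes> (a \<otimes> b)" if h: "h \<in> H" for h
  proof -
    have c: "a \<in> carrier G" "b \<in> carrier G" "h \<in> carrier G"
      "a \<otimes> h = h \<otimes> a" "b \<otimes> h = h \<otimes> b"
      using ab h assms by (auto simp: centralizer_def)
    then show ?thesis by (metis m_assoc)
  qed
  then show "a \<otimes> b \<in> centralizer G H" using ab by (simp add: centralizer_def)
qed

lemma (in group) central_subgroup_normal:
  assumes "subgroup N G" "N \<subseteq> group_center G"
  shows "N \<lhd> G"
proof (unfold normal_inv_iff, intro conjI ballI)
  fix x h assume x: "x \<in> carrier G" and h: "h \<in> N"
  then have "h \<in> carrier G" "h \<otimes> x = x \<otimes> h"
    using assms(2) by (auto simp: group_center_def)
  then have "x \<otimes> h \<otimes> inv x = h"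
    using x by (metis inv_solve_right m_closed)
  then show "x \<otimes> h \<otimes> inv x \<in> N" using h by simp
qed (fact assms(1))

lemma (in group) group_center_subgroup: "subgroup (group_center G) G"
  using centralizer_subgroup[of "carrier G"]
  by (simp add: centralizer_def group_center_def)

lemma (in group) group_center_normal: "group_center G \<lhd> G"
  by (rule central_subgroup_normal[OF group_center_subgroup]) simp

lemma (in group) derived_Int_center_normal:
  "derived G (carrier G) \<inter> group_center G \<lhd> G"
  by (rule central_subgroup_normal)
     (auto intro: subgroups_Inter_pair derived_is_subgroup group_center_subgroup)

lemma (in group) commutator_centralizer_group: "group (commutator_centralizer G)"
  unfolding commutator_centralizer_def
  by (rule subgroup_imp_group, rule centralizer_subgroup, rule derived_in_carrier) simp

end

theory Submission
  imports Defs "HOL-Number_Theory.Pocklington"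
begin

text \<open>
  Write \<open>K = G'\<close>, \<open>A = G' \<inter> Z(G)\<close> and \<open>C = C\<^sub>G(G')\<close>.  Every element of \<open>G\<close> acts by conjugation
  on \<open>K/A\<close>, which has order \<open>p\<close>; as \<open>gcd(p - 1, |G|) = 1\<close>, the action is trivial
  (\<open>normal_prime_order_central\<close>), that is, \<open>[G, K] \<subseteq> A\<close>.  Hence for \<open>k \<in> K - A\<close> the map \<open>g \<mapsto> [g, k]\<close> is
  a homomorphism onto \<open>A\<close> with kernel \<open>C\<close>, and \<open>|G : C| = p\<close>.

  Let \<open>D\<close> be the set of all \<open>x\<close> with \<open>[x, G] \<subseteq> A\<close>, the preimage of the centre of \<open>G/A\<close>.  Since values
  \<open>[x, g]\<close> always lie in \<open>K\<close>, \<open>D\<close> is also the preimage of the centre of \<open>G/Z(G)\<close>.  Conjugation changes the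
  arguments of a commutator by factors in \<open>K\<close>, respectively \<open>A\<close>, and this gives \<open>[C, C] \<subseteq> A\<close> and \<open>D \<subseteq> C\<close>.
  Fix \<open>t \<notin> C\<close>.  On \<open>C\<close> the map \<open>\<phi> : c \<mapsto> [c, t]\<close> is a homomorphism into \<open>K\<close>.  It maps \<open>K\<close> onto \<open>A\<close> and
  \<open>C\<close> onto \<open>K\<close>, and \<open>D\<close> is the preimage of \<open>A\<close> under \<open>\<phi>\<close>.  So \<open>|C : D| = p\<close> and \<open>|G : D| = p\<^sup>2\<close>, which
  yields the two indices of the last claim.  The restriction of \<open>\<phi>\<close> to \<open>Z(C)\<close> has kernel \<open>Z(G)\<close> and an
  image between \<open>A\<close> and \<open>K\<close>, and equal to \<open>K\<close> if \<open>C\<close> is abelian; the restriction to \<open>Z(C) \<inter> D\<close> has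
  image \<open>A\<close>.  This gives \<open>|Z(C)| \<in> {p |Z(G)|, p\<^sup>2 |Z(G)|}\<close> and \<open>|Z(C) \<inter> D| = p |Z(G)|\<close>.

  The commutator is an alternating pairing on \<open>C\<close> with values in the central subgroup \<open>A\<close> of prime order,
  so \<open>|C : Z(C)|\<close> is an even power of \<open>p\<close> (\<open>index_center_even_power\<close>).  Together with \<open>|G : C| = p\<close>
  this gives the order of \<open>G/Z(G)\<close>.

  For the commutativity degree, the conjugacy class of \<open>x\<close> has \<open>1\<close> element if \<open>x \<in> Z(G)\<close>, \<open>p\<close> elements if
  \<open>x\<close> lies in \<open>Z(C) \<union> D\<close> but not in \<open>Z(G)\<close>, and \<open>p\<^sup>2\<close> elements otherwise (\<open>card_centralizer\<close>).
  Summing the orders of the centralizers, the order of \<open>Z(G)\<close> cancels and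
  \<open>p\<^sup>2 |G|\<^sup>2 Pr(G) = |G| (|G| + (p - 1) (|Z(C)| + |D|))\<close>.  The resulting formula with \<open>s\<close> also covers
  abelian \<open>C\<close>, where \<open>s = 0\<close>.
\<close>

section \<open>Commutators\<close>

text \<open>The commutator \<open>[x, y] = x y x\<^sup>-\<^sup>1 y\<^sup>-\<^sup>1\<close>, with the convention used by \<^const>\<open>derived\<close>.\<close>

definition commutator :: "('a, 'b) monoid_scheme \<Rightarrow> 'a \<Rightarrow> 'a \<Rightarrow> 'a" where
  "commutator G x y = x \<otimes>\<^bsub>G\<^esub> y \<otimes>\<^bsub>G\<^esub> inv\<^bsub>G\<^esub> x \<otimes>\<^bsub>G\<^esub> inv\<^bsub>G\<^esub> y"

text \<open>The elements that are central modulo \<open>N\<close>.  For normal \<open>N\<close> this is the preimage of the centre of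
  \<open>G Mod N\<close> (\<open>center_mod_iff\<close> below); the definition by commutators avoids cosets.\<close>

definition center_mod :: "('a, 'b) monoid_scheme \<Rightarrow> 'a set \<Rightarrow> 'a set" where
  "center_mod G N = {x \<in> carrier G. \<forall>g\<in>carrier G. commutator G x g \<in> N}"

context group
begin

lemma inv_cancel_left:
  "\<lbrakk>a \<in> carrier G; b \<in> carrier G\<rbrakk> \<Longrightarrow> inv a \<otimes> (a \<otimes> b) = b"
  "\<lbrakk>a \<in> carrier G; b \<in> carrier G\<rbrakk> \<Longrightarrow> a \<otimes> (inv a \<otimes> b) = b"
  by (simp_all flip: m_assoc)

lemmas word_simps = m_assoc inv_mult_group inv_cancel_left

lemma commutator_closed [simp]:
  "\<lbrakk>x \<in> carrier G; y \<in> carrier G\<rbrakk> \<Longrightarrow> commutator G x y \<in> carrier G"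
  by (simp add: commutator_def)

lemma mult_eq_commutator:
  "\<lbrakk>x \<in> carrier G; y \<in> carrier G\<rbrakk> \<Longrightarrow> x \<otimes> y = commutator G x y \<otimes> (y \<otimes> x)"
  by (simp add: commutator_def word_simps)

lemma conj_eq_commutator:
  "\<lbrakk>x \<in> carrier G; y \<in> carrier G\<rbrakk> \<Longrightarrow> x \<otimes> y \<otimes> inv x = commutator G x y \<otimes> y"
  by (simp add: commutator_def word_simps)

lemma commutator_eq_one_iff:
  assumes "x \<in> carrier G" "y \<in> carrier G"
  shows "commutator G x y = \<one> \<longleftrightarrow> x \<otimes> y = y \<otimes> x"
  using assms mult_eq_commutator[of x y]
  by (metis commutator_closed l_one m_closed one_closed right_cancel)

lemma inv_commutator:
  "\<lbrakk>x \<in> carrier G; y \<in> carrier G\<rbrakk> \<Longrightarrow> inv (commutator G x y) = commutator G y x"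
  by (simp add: commutator_def word_simps)

text \<open>In general \<open>[a b, x] = a [b, x] a\<^sup>-\<^sup>1 [a, x]\<close>.  Note the reversed order of the factors.\<close>

lemma commutator_mult_left:
  assumes "a \<in> carrier G" "b \<in> carrier G" "x \<in> carrier G"
    and "a \<otimes> commutator G b x = commutator G b x \<otimes> a"
  shows "commutator G (a \<otimes> b) x = commutator G b x \<otimes> commutator G a x"
proof -
  have "commutator G (a \<otimes> b) x = a \<otimes> commutator G b x \<otimes> inv a \<otimes> commutator G a x"
    using assms(1-3) by (simp add: commutator_def word_simps)
  also have "a \<otimes> commutator G b x \<otimes> inv a = commutator G b x"
    unfolding assms(4) using assms(1-3) by (simp add: m_assoc)
  finally show ?thesis .
qed

lemma conj_commutator:
  assumes "g \<in> carrier G" "x \<in> carrier G" "y \<in> carrier G"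
  shows "g \<otimes> commutator G x y \<otimes> inv g = commutator G (g \<otimes> x \<otimes> inv g) (g \<otimes> y \<otimes> inv g)"
  using assms by (simp add: commutator_def word_simps)

text \<open>Used with \<open>u = [g, x]\<close> and \<open>v = [g, y]\<close>: then \<open>u x\<close> and \<open>v y\<close> are the conjugates of \<open>x\<close> and \<open>y\<close> by
  \<open>g\<close>, and the conclusion says that \<open>g\<close> commutes with \<open>[x, y]\<close>.  This takes the place of the
  three subgroups lemma.\<close>

lemma commutator_central_factors:
  assumes c: "u \<in> carrier G" "v \<in> carrier G" "x \<in> carrier G" "y \<in> carrier G"
    and "u \<otimes> v = v \<otimes> u" "u \<otimes> x = x \<otimes> u" "u \<otimes> y = y \<otimes> u" "v \<otimes> x = x \<otimes> v" "v \<otimes> y = y \<otimes> v"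
  shows "commutator G (u \<otimes> x) (v \<otimes> y) = commutator G x y"
proof -
  have "(u \<otimes> x) \<otimes> (v \<otimes> y) = (u \<otimes> v) \<otimes> (x \<otimes> y)"
    using assms by (metis m_assoc m_closed)
  also have "\<dots> = (u \<otimes> v) \<otimes> (commutator G x y \<otimes> (y \<otimes> x))"
    using c by (metis mult_eq_commutator)
  also have "\<dots> = commutator G x y \<otimes> ((u \<otimes> v) \<otimes> (y \<otimes> x))"
  proof -
    have "u \<otimes> v \<otimes> x = x \<otimes> (u \<otimes> v)" "u \<otimes> v \<otimes> y = y \<otimes> (u \<otimes> v)"
      using assms by (metis m_assoc)+
    then have "x \<in> centralizer G {u \<otimes> v}" "y \<in> centralizer G {u \<otimes> v}"
      using c by (auto simp: centralizer_def)
    then have "commutator G x y \<in> centralizer G {u \<otimes> v}"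
      unfolding commutator_def using c
      by (intro subgroup.m_closed[OF centralizer_subgroup] subgroup.m_inv_closed[OF centralizer_subgroup]) auto
    then show ?thesis
      using c by (auto simp: centralizer_def simp flip: m_assoc)
  qed
  also have "(u \<otimes> v) \<otimes> (y \<otimes> x) = (v \<otimes> y) \<otimes> (u \<otimes> x)"
    using assms by (metis m_assoc m_closed)
  finally show ?thesis
    using c mult_eq_commutator[of "u \<otimes> x" "v \<otimes> y"]
    by (metis commutator_closed m_closed right_cancel)
qed

lemma commutator_in_derived:
  "\<lbrakk>x \<in> carrier G; y \<in> carrier G\<rbrakk> \<Longrightarrow> commutator G x y \<in> derived G (carrier G)"
  unfolding derived_def commutator_def by (rule generate.incl) blast

lemma derived_subset_iff:
  assumes "subgroup H G"
  shows "derived G (carrier G) \<subseteq> H \<longleftrightarrow> (\<forall>x\<in>carrier G. \<forall>y\<in>carrier G. commutator G x y \<in> H)"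
proof
  show "\<forall>x\<in>carrier G. \<forall>y\<in>carrier G. commutator G x y \<in> H"
    if "derived G (carrier G) \<subseteq> H" using that commutator_in_derived by blast
  show "derived G (carrier G) \<subseteq> H"
    if "\<forall>x\<in>carrier G. \<forall>y\<in>carrier G. commutator G x y \<in> H"
    unfolding derived_def
    by (rule generate_subgroup_incl[OF _ assms]) (use that in \<open>auto simp: commutator_def\<close>)
qed

end

section \<open>Counting with cosets and subgroups of prime index\<close>

context group
begin

lemma in_centralizer_singleton:
  "x \<in> carrier G \<Longrightarrow> y \<in> centralizer G {x} \<longleftrightarrow> y \<in> carrier G \<and> y \<otimes> x = x \<otimes> y"
  by (auto simp: centralizer_def)

lemma centralizer_singleton_subgroup: "x \<in> carrier G \<Longrightarrow> subgroup (centralizer G {x}) G"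
  by (rule centralizer_subgroup) simp

text \<open>The common form of the orbit-stabilizer theorem and the first isomorphism theorem for orders: the
  nonempty fibres of \<open>f\<close> are the left cosets of \<open>K\<close> in \<open>H\<close>.\<close>

lemma card_eq_card_stabilizer_mult_card_image:
  assumes "finite (carrier G)" "subgroup H G" "subgroup K G" "K \<subseteq> H"
    and f: "\<And>a b. \<lbrakk>a \<in> H; b \<in> H\<rbrakk> \<Longrightarrow> f a = f b \<longleftrightarrow> inv a \<otimes> b \<in> K"
  shows "card H = card K * card (f ` H)"
proof -
  have HG: "H \<subseteq> carrier G" and KG: "K \<subseteq> carrier G" using assms subgroup.subset by blast+
  have fin: "finite H" using HG assms(1) finite_subset by blast
  have "card {a \<in> H. f a = y} = card K" if y: "y \<in> f ` H" for y
  proof -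
    obtain a where a: "a \<in> H" "y = f a" using y by blast
    have aG: "a \<in> carrier G" using a HG by blast
    have "{b \<in> H. f b = y} = (\<lambda>k. a \<otimes> k) ` K"
    proof (intro equalityI subsetI)
      fix b assume "b \<in> {b \<in> H. f b = y}"
      then have "b \<in> H" "inv a \<otimes> b \<in> K" using f[of a b] a by auto
      then show "b \<in> (\<lambda>k. a \<otimes> k) ` K"
        using aG HG by (intro image_eqI[of _ _ "inv a \<otimes> b"]) (auto simp: inv_cancel_left)
    next
      fix b assume "b \<in> (\<lambda>k. a \<otimes> k) ` K"
      then obtain k where k: "k \<in> K" "b = a \<otimes> k" by blast
      have "b \<in> H" using k a assms(2,4) by (auto intro: subgroup.m_closed)
      moreover have "inv a \<otimes> b \<in> K" using k aG KG by (auto simp: inv_cancel_left)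
      ultimately show "b \<in> {b \<in> H. f b = y}" using f[of a b] a by auto
    qed
    moreover have "inj_on (\<lambda>k. a \<otimes> k) K"
      using aG KG by (auto simp: inj_on_def subset_iff)
    ultimately show ?thesis by (simp add: card_image)
  qed
  then have "(\<Sum>y\<in>f ` H. card {a \<in> H. f a = y}) = card (f ` H) * card K" by simp
  moreover have "card H = (\<Sum>y\<in>f ` H. card {a \<in> H. f a = y})"
    using sum.image_gen[OF fin, of "\<lambda>_. 1::nat" f] by simp
  ultimately show ?thesis by simp
qed

lemma card_eq_card_centralizer_mult_card_commutators:
  assumes "finite (carrier G)" "subgroup H G" "x \<in> carrier G"
  shows "card H = card (H \<inter> centralizer G {x}) * card ((\<lambda>h. commutator G h x) ` H)"
proof (rule card_eq_card_stabilizer_mult_card_image[OF assms(1,2)])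
  show "subgroup (H \<inter> centralizer G {x}) G"
    using assms centralizer_singleton_subgroup by (blast intro: subgroups_Inter_pair)
next
  fix a b assume ab: "a \<in> H" "b \<in> H"
  then have c: "a \<in> carrier G" "b \<in> carrier G" using assms(2) subgroup.subset by blast+
  have "commutator G a x = commutator G b x \<longleftrightarrow> a \<otimes> x \<otimes> inv a = b \<otimes> x \<otimes> inv b"
    using c assms(3) by (simp add: commutator_def)
  also have "\<dots> \<longleftrightarrow> inv a \<otimes> b \<otimes> x = x \<otimes> (inv a \<otimes> b)"
  proof
    assume "a \<otimes> x \<otimes> inv a = b \<otimes> x \<otimes> inv b"
    then have "inv a \<otimes> (a \<otimes> x \<otimes> inv a) \<otimes> b = inv a \<otimes> (b \<otimes> x \<otimes> inv b) \<otimes> b" by simp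
    then show "inv a \<otimes> b \<otimes> x = x \<otimes> (inv a \<otimes> b)" using c assms(3) by (simp add: word_simps)
  next
    assume "inv a \<otimes> b \<otimes> x = x \<otimes> (inv a \<otimes> b)"
    then have "a \<otimes> (inv a \<otimes> b \<otimes> x) \<otimes> inv b = a \<otimes> (x \<otimes> (inv a \<otimes> b)) \<otimes> inv b" by simp
    then show "a \<otimes> x \<otimes> inv a = b \<otimes> x \<otimes> inv b" using c assms(3) by (simp add: word_simps)
  qed
  finally show "commutator G a x = commutator G b x \<longleftrightarrow> inv a \<otimes> b \<in> H \<inter> centralizer G {x}"
    using c ab assms(2,3)
    by (simp add: in_centralizer_singleton subgroup.m_closed subgroup.m_inv_closed)
qed simp

text \<open>Under the last hypothesis \<open>h \<mapsto> [h, x]\<close> is an antihomomorphism on \<open>H\<close>.\<close>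

lemma subgroup_commutator_image:
  assumes "finite (carrier G)" "subgroup H G" "x \<in> carrier G"
    and comm: "\<And>a b. \<lbrakk>a \<in> H; b \<in> H\<rbrakk> \<Longrightarrow> a \<otimes> commutator G b x = commutator G b x \<otimes> a"
  shows "subgroup ((\<lambda>h. commutator G h x) ` H) G"
proof (rule subgroupI)
  have HG: "H \<subseteq> carrier G" using assms(2) subgroup.subset by blast
  note mult = commutator_mult_left[OF _ _ assms(3) comm]
  show "(\<lambda>h. commutator G h x) ` H \<subseteq> carrier G" using HG assms(3) by auto
  show "(\<lambda>h. commutator G h x) ` H \<noteq> {}" using subgroup.one_closed[OF assms(2)] by blast
  fix c assume "c \<in> (\<lambda>h. commutator G h x) ` H"
  then obtain a where a: "a \<in> H" "c = commutator G a x" by blast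
  have ia: "inv a \<in> H" using a assms(2) by (simp add: subgroup.m_inv_closed)
  have "commutator G \<one> x = \<one>" using assms(3) by (simp add: commutator_eq_one_iff)
  then have "commutator G (inv a) x \<otimes> c = \<one>"
    using mult[of a "inv a"] a ia HG by (auto simp: subset_iff)
  then have "inv c = commutator G (inv a) x"
    using a ia HG assms(3) by (intro inv_equality) auto
  then show "inv c \<in> (\<lambda>h. commutator G h x) ` H" using ia by blast
  fix d assume "d \<in> (\<lambda>h. commutator G h x) ` H"
  then obtain b where b: "b \<in> H" "d = commutator G b x" by blast
  have "c \<otimes> d = commutator G (b \<otimes> a) x" using mult[of b a] a b HG by (auto simp: subset_iff)
  then show "c \<otimes> d \<in> (\<lambda>h. commutator G h x) ` H"
    using a b subgroup.m_closed[OF assms(2)] by blast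
qed

lemma card_subgroup_dvd:
  assumes "subgroup H G" "subgroup K G" "H \<subseteq> K"
  shows "card H dvd card K"
proof -
  interpret K: group "G\<lparr>carrier := K\<rparr>" using assms(2) by (rule subgroup_imp_group)
  show ?thesis
    using K.lagrange[OF subgroup_incl[OF assms(1-3)]] by (simp add: order_def dvd_def mult.commute)
      (metis mult.commute)
qed

text \<open>Subgroups of prime index are maximal.\<close>

lemma prime_index_subgroup_eq:
  assumes "finite (carrier G)" "subgroup H G" "subgroup S G" "subgroup K G" "H \<subseteq> S" "S \<subseteq> K"
    and "card K = q * card H" "Factorial_Ring.prime (q::nat)" "x \<in> S" "x \<notin> H"
  shows "S = K"
proof -
  have fin: "finite S" "finite K" "finite H"
    using assms subgroup.subset finite_subset by metis+
  have "card H > 0" using fin subgroup.one_closed[OF assms(2)] by (auto simp: card_gt_0_iff)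
  obtain k where k: "card S = card H * k"
    using card_subgroup_dvd[OF assms(2,3,5)] by blast
  have "card S dvd card K" using card_subgroup_dvd[OF assms(3,4,6)] .
  then have "k dvd q" using k assms(7) \<open>card H > 0\<close> by (simp add: mult.commute)
  moreover have "card H < card S"
    using assms fin by (intro psubset_card_mono) auto
  then have "k \<noteq> 1" using k by simp
  ultimately have "k = q" using assms(8) by (metis prime_nat_iff)
  then show ?thesis using k assms(6,7) fin by (intro card_subset_eq) auto
qed

lemma prime_order_subgroup_eq:
  assumes "finite (carrier G)" "subgroup S G" "subgroup K G" "S \<subseteq> K"
    and "Factorial_Ring.prime (card K)" "x \<in> S" "x \<noteq> \<one>"
  shows "S = K"
  using assms prime_index_subgroup_eq[of "{\<one>}" S K "card K" x] triv_subgroup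
    subgroup.one_closed[OF assms(2)] by auto

end

section \<open>Normal subgroups of prime order\<close>

text \<open>The order of \<open>m\<close> modulo \<open>p\<close> divides both \<open>p - 1\<close> and \<open>n\<close>.\<close>

lemma cong_1_if_power_cong_1:
  fixes m n p :: nat
  assumes "Factorial_Ring.prime p" "coprime (p - 1) n" "n > 0" "[m ^ n = 1] (mod p)"
  shows "[m = 1] (mod p)"
proof -
  have "coprime p m"
    using assms(3,4) cong_imp_coprime[OF cong_sym[OF assms(4)]]
    by (simp add: coprime_commute)
  then have "[m ^ (p - 1) = 1] (mod p)"
    using assms(1) by (intro fermat_theorem) (metis coprime_absorb_left not_prime_unit)+
  then have "ord p m dvd p - 1" "ord p m dvd n"
    using assms(4) by (simp_all add: ord_divides')
  then have "ord p m = 1"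
    using assms(2) by (metis coprime_common_divisor_nat nat_dvd_1_iff_1 coprime_def)
  then show ?thesis using ord_divides[of m 1 p] by simp
qed

context group
begin

lemma conj_pow:
  assumes "g \<in> carrier G" "x \<in> carrier G"
  shows "g \<otimes> (x [^] (n::nat)) \<otimes> inv g = (g \<otimes> x \<otimes> inv g) [^] n"
proof (induction n)
  case (Suc n)
  have "g \<otimes> (x [^] Suc n) \<otimes> inv g = (g \<otimes> (x [^] n) \<otimes> inv g) \<otimes> (g \<otimes> x \<otimes> inv g)"
    using assms by (simp add: word_simps)
  then show ?case by (simp add: Suc.IH)
qed (use assms in simp)

text \<open>If \<open>g\<close> maps a generator \<open>k\<close> of \<open>N\<close> to \<open>k\<^sup>m\<close>, then \<open>g\<^sup>n\<close> maps it to the power of \<open>k\<close> with exponent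
  \<open>m\<^sup>n\<close>; taking \<open>n = |G|\<close> forces \<open>m \<equiv> 1\<close> modulo \<open>|N|\<close>.\<close>

lemma normal_prime_order_central:
  assumes fin: "finite (carrier G)" and N: "N \<lhd> G" and p: "Factorial_Ring.prime (card N)"
    and cop: "coprime (card N - 1) (order G)"
  shows "N \<subseteq> group_center G"
proof -
  define p where "p = card N"
  have sub: "subgroup N G" using N by (simp add: normal_imp_subgroup)
  have NG: "N \<subseteq> carrier G" using sub subgroup.subset by blast
  have "card N > 1" using p prime_gt_1_nat by blast
  then obtain k where k: "k \<in> N" "k \<noteq> \<one>"
    by (metis card_le_Suc0_iff_eq One_nat_def card.infinite le_less_trans less_irrefl not_le
        not_one_less_zero sub subgroup.one_closed)
  have kG: "k \<in> carrier G" using k NG by blast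
  have gen_sub: "subgroup (generate G {k}) G" using kG by (intro generate_is_subgroup) simp
  have gen: "generate G {k} = N"
    using prime_order_subgroup_eq[OF fin gen_sub sub _ p generate.incl[of k]] k
      generate_subgroup_incl[OF _ sub] by simp
  have ordk: "ord k = p"
    using generate_pow_card[OF kG] gen by (simp add: p_def)
  have Npow: "\<exists>m::nat. x = k [^] m" if "x \<in> N" for x
    using that gen generate_pow_nat[OF kG] ordk p prime_gt_0_nat by (auto simp: p_def)
  have central: "g \<otimes> k = k \<otimes> g" if g: "g \<in> carrier G" for g
  proof -
    have "g \<otimes> k \<otimes> inv g \<in> N" using N k g by (auto simp: normal_inv_iff)
    then obtain m :: nat where m: "g \<otimes> k \<otimes> inv g = k [^] m" using Npow by blast
    have iter: "(g [^] n) \<otimes> k \<otimes> inv (g [^] n) = k [^] (m ^ n)" for n :: nat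
    proof (induction n)
      case (Suc n)
      have "(g [^] Suc n) \<otimes> k \<otimes> inv (g [^] Suc n) = g \<otimes> ((g [^] n) \<otimes> k \<otimes> inv (g [^] n)) \<otimes> inv g"
        unfolding nat_pow_Suc2[OF g] using g kG by (simp add: word_simps)
      also have "\<dots> = (k [^] m) [^] (m ^ n)"
        unfolding Suc.IH using g kG by (simp add: conj_pow m)
      finally show ?case using kG by (simp add: nat_pow_pow)
    qed (use kG in simp)
    have "k = k [^] (m ^ order G)"
      using iter[of "order G"] g kG by (simp add: pow_order_eq_1)
    then have "k [^] int 1 = k [^] int (m ^ order G)"
      using kG by (simp only: int_pow_int) simp
    then have "int p dvd int (m ^ order G) - int 1"
      unfolding int_pow_eq[OF kG] ordk .
    then have "[m ^ order G = 1] (mod p)"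
      by (simp add: cong_iff_dvd_diff flip: cong_int_iff)
    moreover have "order G > 0" using fin by (simp add: order_gt_0_iff_finite)
    ultimately have "[m = 1] (mod p)"
      using cong_1_if_power_cong_1 p cop unfolding p_def by blast
    then have "int p dvd int m - int 1"
      by (simp add: cong_iff_dvd_diff flip: cong_int_iff)
    then have "k [^] int 1 = k [^] int m"
      unfolding int_pow_eq[OF kG] ordk .
    then have "k [^] m = k" using kG by (simp only: int_pow_int) simp
    then show ?thesis using m g kG by (metis inv_solve_right m_closed)
  qed
  then have "N \<subseteq> centralizer G (carrier G)"
    unfolding gen[symmetric]
    by (intro generate_subgroup_incl centralizer_subgroup) (use kG in \<open>auto simp: centralizer_def\<close>)
  then show ?thesis by (simp add: centralizer_def group_center_def)
qed

end

section \<open>Commutators and centres modulo a normal subgroup\<close>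

context group
begin

lemma rcos_eq_iff:
  assumes "N \<lhd> G" "a \<in> carrier G" "b \<in> carrier G"
  shows "N #> a = N #> b \<longleftrightarrow> a \<otimes> inv b \<in> N"
proof -
  have N: "subgroup N G" using assms(1) by (rule normal_imp_subgroup)
  have "N #> a = N #> b \<longleftrightarrow> a \<in> N #> b"
    using repr_independence[OF _ assms(3) N, of a] rcos_self[OF assms(2) N] by auto
  then show ?thesis using subgroup.rcos_module[OF N is_group assms(3,2)] by simp
qed

lemma rcos_commute_iff:
  assumes "N \<lhd> G" "x \<in> carrier G" "y \<in> carrier G"
  shows "(N #> x) \<otimes>\<^bsub>G Mod N\<^esub> (N #> y) = (N #> y) \<otimes>\<^bsub>G Mod N\<^esub> (N #> x) \<longleftrightarrow> commutator G x y \<in> N"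
proof -
  have "x \<otimes> y \<otimes> inv (y \<otimes> x) = commutator G x y"
    using assms by (simp add: commutator_def word_simps)
  then show ?thesis
    using assms by (simp add: normal.rcos_sum rcos_eq_iff)
qed

lemma center_mod_iff:
  assumes "N \<lhd> G" "x \<in> carrier G"
  shows "x \<in> center_mod G N \<longleftrightarrow> N #> x \<in> group_center (G Mod N)"
  using assms rcos_commute_iff[OF assms(1,2)]
  unfolding center_mod_def group_center_def carrier_FactGroup by blast

lemma center_mod_subgroup:
  assumes "N \<lhd> G"
  shows "subgroup (center_mod G N) G"
proof -
  interpret Q: group "G Mod N" using assms by (rule normal.factorgroup_is_group)
  interpret h: group_hom G "G Mod N" "\<lambda>x. N #> x"
    using normal.r_coset_hom_Mod[OF assms] by unfold_locales
  note iff = center_mod_iff[OF assms]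
  note sub = Q.group_center_subgroup
  have carr: "\<And>x. x \<in> center_mod G N \<Longrightarrow> x \<in> carrier G" by (simp add: center_mod_def)
  show ?thesis
  proof
    show "center_mod G N \<subseteq> carrier G" using carr by blast
    show "\<one> \<in> center_mod G N"
      using iff[of \<one>] subgroup.one_closed[OF sub] h.hom_one by simp
    show "x \<otimes> y \<in> center_mod G N" if xy: "x \<in> center_mod G N" "y \<in> center_mod G N" for x y
    proof -
      have c: "x \<in> carrier G" "y \<in> carrier G" using xy carr by auto
      have "(N #> x) \<otimes>\<^bsub>G Mod N\<^esub> (N #> y) \<in> group_center (G Mod N)"
        using xy iff c by (blast intro: subgroup.m_closed[OF sub])
      then show ?thesis using iff[of "x \<otimes> y"] c h.hom_mult[OF c] by simp
    qed
    show "inv x \<in> center_mod G N" if x: "x \<in> center_mod G N" for x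
    proof -
      have c: "x \<in> carrier G" using x carr by auto
      have "inv\<^bsub>G Mod N\<^esub> (N #> x) \<in> group_center (G Mod N)"
        using x iff c by (blast intro: subgroup.m_inv_closed[OF sub])
      then show ?thesis using iff[of "inv x"] c h.hom_inv[OF c] by simp
    qed
  qed
qed

lemma card_rcos_image:
  assumes "finite (carrier G)" "N \<lhd> G" "subgroup K G" "N \<subseteq> K"
  shows "card K = card N * card ((\<lambda>x. N #> x) ` K)"
proof (rule card_eq_card_stabilizer_mult_card_image)
  fix a b assume ab: "a \<in> K" "b \<in> K"
  then have c: "a \<in> carrier G" "b \<in> carrier G" using assms(3) subgroup.subset by blast+
  have "N #> a = N #> b \<longleftrightarrow> b \<otimes> inv a \<in> N"
    using rcos_eq_iff[OF assms(2) c(2,1)] by auto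
  also have "\<dots> \<longleftrightarrow> inv a \<otimes> b \<in> N"
  proof
    assume "b \<otimes> inv a \<in> N"
    then have "inv a \<otimes> (b \<otimes> inv a) \<otimes> inv (inv a) \<in> N"
      using assms(2) inv_closed[OF c(1)] unfolding normal_inv_iff by blast
    then show "inv a \<otimes> b \<in> N" using c by (simp add: word_simps)
  next
    assume "inv a \<otimes> b \<in> N"
    then have "a \<otimes> (inv a \<otimes> b) \<otimes> inv a \<in> N"
      using assms(2) c by (auto simp: normal_inv_iff)
    then show "b \<otimes> inv a \<in> N" using c by (simp add: word_simps)
  qed
  finally show "N #> a = N #> b \<longleftrightarrow> inv a \<otimes> b \<in> N" .
qed (use assms normal_imp_subgroup in auto)

lemma index_center_FactGroup:
  assumes fin: "finite (carrier G)" and N: "N \<lhd> G"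
  shows "subgroup_index (G Mod N) (group_center (G Mod N)) * card (center_mod G N) = order G"
proof -
  interpret Q: group "G Mod N" using N by (rule normal.factorgroup_is_group)
  have eq: "group_center (G Mod N) = (\<lambda>x. N #> x) ` center_mod G N"
  proof (intro equalityI subsetI)
    fix W assume W: "W \<in> group_center (G Mod N)"
    then obtain x where "x \<in> carrier G" "W = N #> x"
      by (auto simp: group_center_def carrier_FactGroup)
    then show "W \<in> (\<lambda>x. N #> x) ` center_mod G N" using W center_mod_iff[OF N] by blast
  next
    fix W assume "W \<in> (\<lambda>x. N #> x) ` center_mod G N"
    then show "W \<in> group_center (G Mod N)"
      using center_mod_iff[OF N] by (auto simp: center_mod_def)
  qed
  have sub: "N \<subseteq> center_mod G N"
  proof
    fix x assume x: "x \<in> N"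
    have xG: "x \<in> carrier G" using x normal_imp_subgroup[OF N] subgroup.subset by blast
    have "commutator G x g \<in> N" if "g \<in> carrier G" for g
    proof -
      have "commutator G x g = x \<otimes> (g \<otimes> inv x \<otimes> inv g)"
        using xG that by (simp add: commutator_def word_simps)
      then show ?thesis
        using x that N normal_imp_subgroup[OF N]
        by (auto simp: normal_inv_iff subgroup.m_closed subgroup.m_inv_closed)
    qed
    then show "x \<in> center_mod G N" using xG by (simp add: center_mod_def)
  qed
  have "card (center_mod G N) = card N * card (group_center (G Mod N))"
    unfolding eq using card_rcos_image[OF fin N center_mod_subgroup[OF N] sub] .
  moreover have "card (rcosets\<^bsub>G Mod N\<^esub> group_center (G Mod N)) * card (group_center (G Mod N)) = order (G Mod N)"
    by (rule Q.lagrange[OF Q.group_center_subgroup])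
  moreover have "order (G Mod N) * card N = order G"
    using lagrange[OF normal_imp_subgroup[OF N]] by (simp add: order_def FactGroup_def)
  ultimately show ?thesis by (simp add: subgroup_index_def ac_simps)
qed

lemma commutator_in_sym:
  assumes "subgroup N G" "x \<in> carrier G" "y \<in> carrier G"
  shows "commutator G x y \<in> N \<longleftrightarrow> commutator G y x \<in> N"
  using assms inv_commutator[of x y] inv_commutator[of y x] subgroup.m_inv_closed[OF assms(1)]
  by metis

text \<open>The preimage of the centralizer of \<open>N #> x\<close> in \<open>G Mod N\<close>.\<close>

lemma centralizer_mod_subgroup:
  assumes N: "N \<lhd> G" and x: "x \<in> carrier G"
  shows "subgroup {g \<in> carrier G. commutator G g x \<in> N} G"
proof -
  have sub: "subgroup N G" using N by (rule normal_imp_subgroup)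
  have conj: "\<And>g h. \<lbrakk>g \<in> carrier G; h \<in> N\<rbrakk> \<Longrightarrow> g \<otimes> h \<otimes> inv g \<in> N"
    using N by (simp add: normal_inv_iff)
  show ?thesis
  proof
    have "commutator G \<one> x = \<one>" using x by (simp add: commutator_eq_one_iff)
    then show "\<one> \<in> {g \<in> carrier G. commutator G g x \<in> N}"
      using subgroup.one_closed[OF sub] by simp
  next
    fix a b assume "a \<in> {g \<in> carrier G. commutator G g x \<in> N}" "b \<in> {g \<in> carrier G. commutator G g x \<in> N}"
    then have c: "a \<in> carrier G" "b \<in> carrier G" "commutator G a x \<in> N" "commutator G b x \<in> N"
      by auto
    have "commutator G (a \<otimes> b) x = (a \<otimes> commutator G b x \<otimes> inv a) \<otimes> commutator G a x"
      using c(1,2) x by (simp add: commutator_def word_simps)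
    also have "\<dots> \<in> N" using subgroup.m_closed[OF sub conj] c by blast
    finally show "a \<otimes> b \<in> {g \<in> carrier G. commutator G g x \<in> N}" using c by simp
  next
    fix a assume "a \<in> {g \<in> carrier G. commutator G g x \<in> N}"
    then have c: "a \<in> carrier G" "commutator G a x \<in> N" by auto
    have "commutator G (inv a) x = inv a \<otimes> inv (commutator G a x) \<otimes> inv (inv a)"
      using c(1) x by (simp add: commutator_def word_simps)
    also have "\<dots> \<in> N" using conj[of "inv a" "inv (commutator G a x)"] subgroup.m_inv_closed[OF sub] c by simp
    finally show "inv a \<in> {g \<in> carrier G. commutator G g x \<in> N}" using c by simp
  qed auto
qed

lemma commutator_in_if_index_prime_coprime:
  assumes fin: "finite (carrier G)" and p: "Factorial_Ring.prime p" and cop: "coprime (p - 1) (order G)"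
    and N: "N \<lhd> G" and K: "K \<lhd> G" and NK: "N \<subseteq> K" and card: "card K = p * card N"
    and k: "k \<in> K" and g: "g \<in> carrier G"
  shows "commutator G k g \<in> N"
proof -
  interpret Q: group "G Mod N" using N by (rule normal.factorgroup_is_group)
  let ?K = "(\<lambda>x. N #> x) ` K"
  have finN: "finite N" "finite K"
    using fin N K normal_imp_subgroup subgroup.subset finite_subset by metis+
  have KG: "K \<subseteq> carrier G" using K normal_imp_subgroup subgroup.subset by blast
  have N0: "card N > 0"
    using finN subgroup.one_closed[OF normal_imp_subgroup[OF N]] by (auto simp: card_gt_0_iff)
  have cK: "card ?K = p"
    using card_rcos_image[OF fin N normal_imp_subgroup[OF K] NK] card N0 by simp
  have finQ: "finite (carrier (G Mod N))" using fin by (simp add: carrier_FactGroup)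
  have ord: "order (G Mod N) dvd order G"
    using lagrange[OF normal_imp_subgroup[OF N]] by (metis dvd_triv_left order_def FactGroup_def partial_object.select_convs(1))
  have nK: "?K \<lhd> G Mod N"
    using normality_factorization[OF N NK K] by (simp add: RCOSETS_def r_coset_def UNION_singleton_eq_range)
  have "?K \<subseteq> group_center (G Mod N)"
    using Q.normal_prime_order_central[OF finQ nK] cK p coprime_divisors[OF _ ord cop, of "p - 1"]
    by simp
  then have "N #> k \<in> group_center (G Mod N)" using k by blast
  then have "(N #> k) \<otimes>\<^bsub>G Mod N\<^esub> (N #> g) = (N #> g) \<otimes>\<^bsub>G Mod N\<^esub> (N #> k)"
    using g by (simp add: group_center_def carrier_FactGroup)
  then show ?thesis using rcos_commute_iff[OF N _ g] k KG by blast
qed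

end

section \<open>The index of the centre when all commutators lie in a central subgroup of prime order\<close>

context group
begin

text \<open>The commutator induces a nondegenerate alternating form on \<open>H/Z(H)\<close> with values in \<open>A\<close>.  As for such
  forms, hyperbolic planes are split off: for noncommuting \<open>x, y\<close> the subgroup \<open>U\<close> of all elements of \<open>H\<close> that
  commute with both has index \<open>|A|\<^sup>2\<close> and the same centre as \<open>H\<close>.\<close>

lemma index_center_even_power:
  assumes fin: "finite (carrier G)" and A: "subgroup A G" "Factorial_Ring.prime (card A)"
    and "subgroup H G"
    and "\<And>x y. \<lbrakk>x \<in> H; y \<in> H\<rbrakk> \<Longrightarrow> commutator G x y \<in> A"
    and "\<And>x a. \<lbrakk>x \<in> H; a \<in> A\<rbrakk> \<Longrightarrow> x \<otimes> a = a \<otimes> x"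
  shows "\<exists>s. card H = card A ^ (2 * s) * card (H \<inter> centralizer G H)"
  using assms(4-)
proof (induction "card H" arbitrary: H rule: less_induct)
  case less
  note H = less.prems
  have HG: "H \<subseteq> carrier G" using H(1) subgroup.subset by blast
  show ?case
  proof (cases "\<forall>x\<in>H. \<forall>y\<in>H. x \<otimes> y = y \<otimes> x")
    case True
    then have "H \<inter> centralizer G H = H" using HG by (auto simp: centralizer_def)
    then show ?thesis by (intro exI[of _ 0]) simp
  next
    case False
    then obtain x y where xy: "x \<in> H" "y \<in> H" "x \<otimes> y \<noteq> y \<otimes> x" by blast
    have index: "card S = card A * card (S \<inter> centralizer G {v})"
      if S: "subgroup S G" "S \<subseteq> H" and u: "u \<in> S" and v: "v \<in> H" and uv: "u \<otimes> v \<noteq> v \<otimes> u" for S u v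
    proof -
      have c: "u \<in> carrier G" "v \<in> carrier G" using u v S HG by auto
      let ?I = "(\<lambda>h. commutator G h v) ` S"
      have "subgroup ?I G"
        using S(2) v c(2) by (intro subgroup_commutator_image[OF fin S(1)] H(3) H(2)) auto
      moreover have "?I \<subseteq> A" using H(2) S v by auto
      moreover have "commutator G u v \<noteq> \<one>" using uv c by (simp add: commutator_eq_one_iff)
      ultimately have "?I = A"
        using u by (intro prime_order_subgroup_eq[OF fin _ A(1) _ A(2), of _ "commutator G u v"]) auto
      then show ?thesis
        using card_eq_card_centralizer_mult_card_commutators[OF fin S(1) c(2)] by simp
    qed
    have c: "x \<in> carrier G" "y \<in> carrier G" using xy HG by auto
    define W where "W = H \<inter> centralizer G {x}"
    define U where "U = W \<inter> centralizer G {y}"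
    have W: "subgroup W G" and U: "subgroup U G"
      unfolding W_def U_def using H(1) c centralizer_singleton_subgroup
      by (blast intro: subgroups_Inter_pair)+
    have UWH: "U \<subseteq> W" "W \<subseteq> H" "U \<subseteq> H" by (auto simp: U_def W_def)
    have xW: "x \<in> W" using xy c by (simp add: W_def in_centralizer_singleton)
    have cardH: "card H = card A * card W"
      unfolding W_def using index[OF H(1) _ xy(2) xy(1)] xy by auto
    have cardW: "card W = card A * card U"
      unfolding U_def using index[OF W UWH(2) xW xy(2,3)] .
    have "finite U" using fin U subgroup.subset finite_subset by metis
    then have "card U > 0" using subgroup.one_closed[OF U] by (auto simp: card_gt_0_iff)
    moreover have "card A > 1" using A(2) prime_gt_1_nat by blast
    ultimately have less: "card U < card H"
      using cardH cardW by (simp add: one_less_mult)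
    obtain s where s: "card U = card A ^ (2 * s) * card (U \<inter> centralizer G U)"
      using less.hyps[OF less U H(2) H(3)] UWH(3) by (auto simp: subset_iff)
    \<comment> \<open>An element of \<open>Z(U)\<close> commutes with \<open>U\<close>, \<open>x\<close> and \<open>y\<close>, hence with \<open>W\<close> (of prime index over \<open>U\<close>, and
      containing \<open>x\<close>), hence with \<open>H\<close> (of prime index over \<open>W\<close>, and containing \<open>y\<close>).\<close>
    have "U \<inter> centralizer G U = H \<inter> centralizer G H"
    proof (intro equalityI subsetI)
      fix z assume z: "z \<in> H \<inter> centralizer G H"
      then have "z \<in> U" using c xy by (auto simp: U_def W_def centralizer_def)
      then show "z \<in> U \<inter> centralizer G U" using z UWH by (auto simp: centralizer_def)
    next
      fix z assume z: "z \<in> U \<inter> centralizer G U"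
      have zG: "z \<in> carrier G" using z UWH HG by blast
      define S where "S = H \<inter> centralizer G {z}"
      have S: "subgroup S G"
        unfolding S_def using H(1) zG centralizer_singleton_subgroup by (blast intro: subgroups_Inter_pair)
      have US: "U \<subseteq> S"
        using z UWH HG by (auto simp: S_def centralizer_def)
      have xyS: "x \<in> S" "y \<in> S" using z xy c
        by (auto simp: S_def U_def W_def centralizer_def)
      have xU: "x \<notin> U" using xy by (auto simp: U_def centralizer_def)
      have "S \<inter> W = W"
        by (rule prime_index_subgroup_eq[OF fin U _ W _ _ cardW A(2), of _ x])
          (use S W US UWH xW xyS xU in \<open>auto intro: subgroups_Inter_pair\<close>)
      then have "W \<subseteq> S" by blast
      have "S = H"
        by (rule prime_index_subgroup_eq[OF fin W S H(1) \<open>W \<subseteq> S\<close> _ cardH A(2), of y])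
          (use xyS xy in \<open>auto simp: S_def W_def centralizer_def\<close>)
      then have "z \<otimes> h = h \<otimes> z" if "h \<in> H" for h
        using that zG unfolding \<open>S = H\<close>[symmetric] by (auto simp: S_def centralizer_def)
      then show "z \<in> H \<inter> centralizer G H" using z zG UWH by (auto simp: centralizer_def)
    qed
    then have "card H = card A ^ (2 * Suc s) * card (H \<inter> centralizer G H)"
      using cardH cardW s by (simp add: power_add)
    then show ?thesis by blast
  qed
qed

end

section \<open>Groups whose derived subgroup has order the square of a prime\<close>

text \<open>The standing hypotheses on \<open>G\<close> and \<open>p\<close>.\<close>

locale derived_prime_square = group G for G (structure) +
  fixes p :: nat
  assumes fin: "finite (carrier G)"
    and p: "Factorial_Ring.prime p"
    and cop: "coprime (p - 1) (order G)"
    and card_derived: "card (derived G (carrier G)) = p ^ 2"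
    and card_derived_center: "card (derived G (carrier G) \<inter> group_center G) = p"
begin

text \<open>\<open>D\<close> is the preimage of the centre of \<open>G/A\<close>, and \<open>ZC\<close> is the centre of \<open>C\<close> (\<open>group_center_C\<close> below).\<close>

abbreviation "K \<equiv> derived G (carrier G)"
abbreviation "Z \<equiv> group_center G"
abbreviation "A \<equiv> K \<inter> Z"
abbreviation "C \<equiv> centralizer G K"
abbreviation "D \<equiv> center_mod G A"
abbreviation "ZC \<equiv> C \<inter> centralizer G C"

lemma p_gt_1: "p > 1" using p prime_gt_1_nat by blast

lemma K_sub: "subgroup K G" by (rule derived_is_subgroup) simp
lemma A_normal: "A \<lhd> G" by (rule derived_Int_center_normal)
lemma A_sub: "subgroup A G" using A_normal by (rule normal_imp_subgroup)
lemma K_carrier: "K \<subseteq> carrier G" using K_sub subgroup.subset by blast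
lemma C_sub: "subgroup C G" using K_carrier by (rule centralizer_subgroup)
lemma C_carrier: "C \<subseteq> carrier G" by (auto simp: centralizer_def)
lemma D_sub: "subgroup D G" using A_normal by (rule center_mod_subgroup)
lemma ZC_sub: "subgroup ZC G"
  by (rule subgroups_Inter_pair[OF C_sub centralizer_subgroup[OF C_carrier]])
lemma A_central: "\<lbrakk>a \<in> A; g \<in> carrier G\<rbrakk> \<Longrightarrow> g \<otimes> a = a \<otimes> g"
  by (auto simp: group_center_def)
lemma A_carrier: "A \<subseteq> carrier G" using K_carrier by blast
lemma one_in_A: "\<one> \<in> A" using A_sub by (rule subgroup.one_closed)

lemma commutator_derived_in_center:
  assumes "k \<in> K" "g \<in> carrier G"
  shows "commutator G k g \<in> A" "commutator G g k \<in> A"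
proof -
  show "commutator G k g \<in> A"
    by (rule commutator_in_if_index_prime_coprime[OF fin p cop A_normal derived_self_is_normal])
      (use assms in \<open>auto simp: card_derived card_derived_center power2_eq_square\<close>)
  then show "commutator G g k \<in> A"
    using commutator_in_sym[OF A_sub] assms K_carrier by blast
qed

lemma ex_noncentral_derived: "\<exists>k. k \<in> K \<and> k \<notin> A"
proof (rule ccontr)
  assume "\<not> ?thesis"
  then have "K = A" by blast
  then have "p ^ 2 = p" using card_derived card_derived_center by metis
  then show False using p_gt_1 by (simp add: power2_eq_square)
qed

text \<open>\<open>A\<close> has prime index in \<open>K\<close>, so that \<open>A\<close> and any one further element generate \<open>K\<close>.\<close>

lemma derived_subset_if:
  assumes "subgroup S G" "A \<subseteq> S" "k \<in> K" "k \<in> S" "k \<notin> A"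
  shows "K \<subseteq> S"
proof -
  have "S \<inter> K = K"
    by (rule prime_index_subgroup_eq[OF fin A_sub _ K_sub, of _ p k])
      (use assms K_sub p in \<open>auto simp: card_derived card_derived_center power2_eq_square intro: subgroups_Inter_pair\<close>)
  then show ?thesis by blast
qed

lemma A_centralizes: "x \<in> carrier G \<Longrightarrow> A \<subseteq> centralizer G {x}"
  using A_central A_carrier by (fastforce simp: centralizer_def)

lemma derived_subset_centralizer: "K \<subseteq> C"
proof
  fix k assume k: "k \<in> K"
  then have kG: "k \<in> carrier G" using K_carrier by blast
  have "K \<subseteq> centralizer G {k}"
  proof (cases "k \<in> A")
    case True
    then show ?thesis using A_central K_carrier by (auto simp: centralizer_def)
  next
    case False
    show ?thesis
      by (rule derived_subset_if[OF centralizer_singleton_subgroup[OF kG] A_centralizes[OF kG] k])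
        (use False kG in \<open>auto simp: centralizer_def\<close>)
  qed
  then show "k \<in> C" using kG by (auto simp: centralizer_def)
qed

lemma centralizer_derived_eq:
  assumes "k \<in> K" "k \<notin> A"
  shows "centralizer G {k} = C"
proof (intro equalityI subsetI)
  fix x assume x: "x \<in> centralizer G {k}"
  have xG: "x \<in> carrier G" using x by (simp add: centralizer_def)
  have "K \<subseteq> centralizer G {x}"
    by (rule derived_subset_if[OF centralizer_singleton_subgroup[OF xG] A_centralizes[OF xG] assms(1)])
      (use x assms K_carrier in \<open>auto simp: centralizer_def\<close>)
  then show "x \<in> C" using xG by (auto simp: centralizer_def)
qed (use assms in \<open>auto simp: centralizer_def\<close>)

lemma commutator_image_eq_A:
  assumes H: "subgroup H G" and x: "x \<in> carrier G"
    and A: "\<And>h. h \<in> H \<Longrightarrow> commutator G h x \<in> A" and u: "u \<in> H" "u \<otimes> x \<noteq> x \<otimes> u"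
  shows "(\<lambda>h. commutator G h x) ` H = A"
proof (rule prime_order_subgroup_eq[OF fin _ A_sub, of _ "commutator G u x"])
  have HG: "H \<subseteq> carrier G" using H subgroup.subset by blast
  show "subgroup ((\<lambda>h. commutator G h x) ` H) G"
    using A HG by (intro subgroup_commutator_image[OF fin H x] A_central) auto
  show "(\<lambda>h. commutator G h x) ` H \<subseteq> A" using A by blast
  show "commutator G u x \<noteq> \<one>" using u x HG by (auto simp: commutator_eq_one_iff)
qed (use u p in \<open>auto simp: card_derived_center\<close>)

lemma card_eq_if_commutators_in_A:
  assumes "subgroup H G" "x \<in> carrier G" "\<And>h. h \<in> H \<Longrightarrow> commutator G h x \<in> A"
    and "u \<in> H" "u \<otimes> x \<noteq> x \<otimes> u"
  shows "card H = p * card (H \<inter> centralizer G {x})"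
  using card_eq_card_centralizer_mult_card_commutators[OF fin assms(1,2)]
    commutator_image_eq_A[OF assms] by (simp add: card_derived_center)

lemma card_carrier: "card (carrier G) = p * card C"
proof -
  obtain k where k: "k \<in> K" "k \<notin> A" using ex_noncentral_derived by blast
  have kG: "k \<in> carrier G" using k K_carrier by blast
  then obtain g where "g \<in> carrier G" "g \<otimes> k \<noteq> k \<otimes> g" using k by (fastforce simp: group_center_def)
  then have "card (carrier G) = p * card (carrier G \<inter> centralizer G {k})"
    using commutator_derived_in_center(2)[OF k(1)] by (intro card_eq_if_commutators_in_A subgroup_self kG)
  then show ?thesis
    using centralizer_derived_eq[OF k] C_carrier by (simp add: Int_absorb1)
qed

lemma subgroup_eq_carrier:
  assumes "subgroup S G" "C \<subseteq> S" "t \<in> S" "t \<notin> C"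
  shows "S = carrier G"
  using prime_index_subgroup_eq[OF fin C_sub assms(1) subgroup_self assms(2) _ card_carrier p assms(3,4)]
    assms(1) subgroup.subset by blast

lemma card_C_pos: "card C > 0"
  using fin finite_subset[OF C_carrier] subgroup.one_closed[OF C_sub] by (auto simp: card_gt_0_iff)

lemma ex_not_in_C: "\<exists>t. t \<in> carrier G \<and> t \<notin> C"
proof (rule ccontr)
  assume "\<not> ?thesis"
  then have "C = carrier G" using C_carrier by blast
  then have "card C = p * card C" using card_carrier by metis
  then show False using card_C_pos p_gt_1 by simp
qed

text \<open>For \<open>x, y \<in> C\<close> the factors \<open>[g, x], [g, y] \<in> K\<close> by which conjugation changes \<open>x\<close> and \<open>y\<close> commute with \<open>C\<close>
  and with each other, so \<open>[x, y]\<close> is central.\<close>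

lemma commutator_centralizer_in_center:
  assumes "x \<in> C" "y \<in> C"
  shows "commutator G x y \<in> A"
proof -
  have c: "x \<in> carrier G" "y \<in> carrier G" using assms C_carrier by auto
  have "commutator G x y \<otimes> g = g \<otimes> commutator G x y" if g: "g \<in> carrier G" for g
  proof -
    have KC: "\<And>u v. \<lbrakk>u \<in> K; v \<in> C\<rbrakk> \<Longrightarrow> u \<otimes> v = v \<otimes> u" by (auto simp: centralizer_def)
    have K: "commutator G g x \<in> K" "commutator G g y \<in> K"
      using c g by (auto intro: commutator_in_derived)
    have "g \<otimes> commutator G x y \<otimes> inv g = commutator G (commutator G g x \<otimes> x) (commutator G g y \<otimes> y)"
      unfolding conj_commutator[OF g c] conj_eq_commutator[OF g c(1)] conj_eq_commutator[OF g c(2)] ..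
    also have "\<dots> = commutator G x y"
      using K c g KC assms derived_subset_centralizer by (intro commutator_central_factors) auto
    finally show ?thesis using c g by (metis inv_solve_right m_closed commutator_closed)
  qed
  then show ?thesis using c commutator_in_derived by (auto simp: group_center_def)
qed

text \<open>An element \<open>x \<in> D\<close> changes \<open>g\<close> and \<open>h\<close> only by central factors and therefore fixes every \<open>[g, h]\<close>.\<close>

lemma D_subset_C: "D \<subseteq> C"
proof
  fix x assume x: "x \<in> D"
  then have xG: "x \<in> carrier G" and xA: "\<And>g. g \<in> carrier G \<Longrightarrow> commutator G x g \<in> A"
    by (auto simp: center_mod_def)
  have "commutator G g h \<in> centralizer G {x}" if gh: "g \<in> carrier G" "h \<in> carrier G" for g h
  proof -
    have a: "\<And>u v. \<lbrakk>u \<in> carrier G; v \<in> carrier G\<rbrakk> \<Longrightarrow> commutator G x u \<otimes> v = v \<otimes> commutator G x u"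
      using xA A_central by metis
    have "x \<otimes> commutator G g h \<otimes> inv x = commutator G (commutator G x g \<otimes> g) (commutator G x h \<otimes> h)"
      unfolding conj_commutator[OF xG gh] conj_eq_commutator[OF xG gh(1)] conj_eq_commutator[OF xG gh(2)] ..
    also have "\<dots> = commutator G g h"
      using xG gh by (intro commutator_central_factors a) auto
    finally have "x \<otimes> commutator G g h = commutator G g h \<otimes> x"
      using xG gh by (metis inv_solve_right m_closed commutator_closed)
    then show ?thesis using xG gh by (simp add: in_centralizer_singleton)
  qed
  then have "K \<subseteq> centralizer G {x}"
    using derived_subset_iff[OF centralizer_singleton_subgroup[OF xG]] by blast
  then show "x \<in> C" using xG by (auto simp: centralizer_def)
qed

text \<open>The elements \<open>g\<close> with \<open>[g, x] \<in> A\<close> form a subgroup; it contains \<open>C\<close> and \<open>t\<close>, hence is \<open>G\<close>.\<close>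

lemma in_D_if:
  assumes x: "x \<in> C" and t: "t \<in> carrier G" "t \<notin> C" and xt: "commutator G x t \<in> A"
  shows "x \<in> D"
proof -
  have xG: "x \<in> carrier G" using x C_carrier by blast
  let ?S = "{g \<in> carrier G. commutator G g x \<in> A}"
  have "?S = carrier G"
    by (rule subgroup_eq_carrier[OF centralizer_mod_subgroup[OF A_normal xG], of t])
      (use commutator_centralizer_in_center[OF _ x] C_carrier t xt commutator_in_sym[OF A_sub xG t(1)] in auto)
  then have "commutator G x g \<in> A" if "g \<in> carrier G" for g
    using that commutator_in_sym[OF A_sub xG that] by blast
  then show ?thesis using xG by (simp add: center_mod_def)
qed

lemma Z_subset: "Z \<subseteq> ZC \<inter> D"
proof
  fix z assume z: "z \<in> Z"
  then have "commutator G z g = \<one>" if "g \<in> carrier G" for g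
    using that by (auto simp: group_center_def commutator_eq_one_iff)
  then show "z \<in> ZC \<inter> D"
    using z K_carrier C_carrier subgroup.one_closed[OF A_sub]
    by (auto simp: group_center_def centralizer_def center_mod_def)
qed

lemma derived_subset_D: "K \<subseteq> D"
  unfolding center_mod_def using commutator_derived_in_center(1) K_carrier by blast

lemma derived_subset_ZC: "K \<subseteq> ZC"
proof -
  have "k \<otimes> c = c \<otimes> k" if "k \<in> K" "c \<in> C" for k c
    using that by (simp add: centralizer_def)
  then have "K \<subseteq> centralizer G C" using K_carrier unfolding centralizer_def[of G C] by blast
  then show ?thesis using derived_subset_centralizer by blast
qed

context
  fixes t assumes t: "t \<in> carrier G" "t \<notin> C"
begin

lemma commutators_derived: "(\<lambda>h. commutator G h t) ` K = A"
proof -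
  obtain k where k: "k \<in> K" "t \<otimes> k \<noteq> k \<otimes> t" using t by (auto simp: centralizer_def)
  show ?thesis
    by (rule commutator_image_eq_A[OF K_sub t(1) _ k(1)])
      (use k t commutator_derived_in_center(1) in auto)
qed

text \<open>Otherwise \<open>t\<close> would commute with \<open>C\<close> and with itself modulo \<open>A\<close>, hence with all of \<open>G\<close>, and so would lie
  in \<open>D \<subseteq> C\<close>.\<close>

lemma ex_commutator_not_in_A: "\<exists>c\<in>C. commutator G c t \<notin> A"
proof (rule ccontr)
  assume "\<not> ?thesis"
  then have c: "\<And>c. c \<in> C \<Longrightarrow> commutator G c t \<in> A" by blast
  have "commutator G t t \<in> A" using t one_in_A commutator_eq_one_iff[of t t] by simp
  then have "{g \<in> carrier G. commutator G g t \<in> A} = carrier G"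
    using c C_carrier t
    by (intro subgroup_eq_carrier[OF centralizer_mod_subgroup[OF A_normal t(1)], of t]) auto
  then have "commutator G t g \<in> A" if "g \<in> carrier G" for g
    using that commutator_in_sym[OF A_sub t(1) that] by blast
  then have "t \<in> D" using t by (simp add: center_mod_def)
  then show False using D_subset_C t by blast
qed

lemma commutators_centralizer_subgroup:
  assumes H: "subgroup H G" "H \<subseteq> C"
  shows "subgroup ((\<lambda>h. commutator G h t) ` H) G"
proof (rule subgroup_commutator_image[OF fin H(1) t(1)])
  fix a b assume ab: "a \<in> H" "b \<in> H"
  then have "commutator G b t \<in> K" using commutator_in_derived t H C_carrier by blast
  then show "a \<otimes> commutator G b t = commutator G b t \<otimes> a"
    using ab H by (auto simp: centralizer_def)
qed

lemma commutators_centralizer: "(\<lambda>h. commutator G h t) ` C = K"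
proof
  show "(\<lambda>h. commutator G h t) ` C \<subseteq> K" using commutator_in_derived t C_carrier by blast
  obtain c where c: "c \<in> C" "commutator G c t \<notin> A" using ex_commutator_not_in_A by blast
  have "A \<subseteq> (\<lambda>h. commutator G h t) ` C"
    unfolding commutators_derived[symmetric] using derived_subset_centralizer by blast
  then show "K \<subseteq> (\<lambda>h. commutator G h t) ` C"
    by (rule derived_subset_if[OF commutators_centralizer_subgroup[OF C_sub order.refl], of "commutator G c t"])
      (use c t C_carrier commutator_in_derived in auto)
qed

lemma centralizer_outside: "order G = p ^ 2 * card (centralizer G {t})"
proof -
  have "(\<lambda>h. commutator G h t) ` carrier G = K"
    using commutators_centralizer C_carrier commutator_in_derived t by blast
  then have "card (carrier G) = card (carrier G \<inter> centralizer G {t}) * p ^ 2"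
    using card_eq_card_centralizer_mult_card_commutators[OF fin subgroup_self t(1)] card_derived by simp
  moreover have "carrier G \<inter> centralizer G {t} = centralizer G {t}" by (auto simp: centralizer_def)
  ultimately show ?thesis by (simp add: order_def)
qed

lemma ZC_Int_centralizer: "ZC \<inter> centralizer G {t} = Z"
proof (intro equalityI subsetI)
  fix z assume z: "z \<in> ZC \<inter> centralizer G {t}"
  then have zG: "z \<in> carrier G" by (auto simp: centralizer_def)
  have "centralizer G {z} = carrier G"
    by (rule subgroup_eq_carrier[OF centralizer_singleton_subgroup[OF zG], of t])
      (use z t C_carrier in \<open>auto simp: centralizer_def\<close>)
  then have "\<forall>g\<in>carrier G. g \<otimes> z = z \<otimes> g" using zG in_centralizer_singleton by blast
  then show "z \<in> Z" using zG by (simp add: group_center_def)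
next
  fix z assume z: "z \<in> Z"
  then have "z \<in> centralizer G {t}" using t by (simp add: in_centralizer_singleton group_center_def)
  then show "z \<in> ZC \<inter> centralizer G {t}" using z Z_subset by blast
qed

end

lemma card_C: "card C = p * card D"
proof -
  obtain t where t: "t \<in> carrier G" "t \<notin> C" using ex_not_in_C by blast
  note card = card_eq_card_centralizer_mult_card_commutators[OF fin _ t(1)]
  have "D \<inter> centralizer G {t} = C \<inter> centralizer G {t}"
  proof (intro equalityI subsetI)
    fix x assume x: "x \<in> C \<inter> centralizer G {t}"
    then have "commutator G x t = \<one>" using t by (auto simp: centralizer_def commutator_eq_one_iff)
    then show "x \<in> D \<inter> centralizer G {t}" using x in_D_if[OF _ t] one_in_A by auto
  qed (use D_subset_C in blast)
  moreover have "(\<lambda>h. commutator G h t) ` D = A"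
  proof
    show "(\<lambda>h. commutator G h t) ` D \<subseteq> A" using t by (auto simp: center_mod_def)
    show "A \<subseteq> (\<lambda>h. commutator G h t) ` D"
      using image_mono[OF derived_subset_D, of "\<lambda>h. commutator G h t"] unfolding commutators_derived[OF t] .
  qed
  ultimately show ?thesis
    using card[OF C_sub] card[OF D_sub] commutators_centralizer[OF t]
    by (simp add: card_derived card_derived_center power2_eq_square)
qed

lemma card_ZC_Int_D: "card (ZC \<inter> D) = p * card Z"
proof -
  obtain t where t: "t \<in> carrier G" "t \<notin> C" using ex_not_in_C by blast
  have "(\<lambda>h. commutator G h t) ` (ZC \<inter> D) = A"
  proof
    show "(\<lambda>h. commutator G h t) ` (ZC \<inter> D) \<subseteq> A" using t by (auto simp: center_mod_def)
    have "K \<subseteq> ZC \<inter> D" using derived_subset_D derived_subset_ZC by blast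
    from image_mono[OF this, of "\<lambda>h. commutator G h t"]
    show "A \<subseteq> (\<lambda>h. commutator G h t) ` (ZC \<inter> D)" unfolding commutators_derived[OF t] .
  qed
  moreover have "ZC \<inter> D \<inter> centralizer G {t} = Z" using ZC_Int_centralizer[OF t] Z_subset by blast
  ultimately show ?thesis
    using card_eq_card_centralizer_mult_card_commutators[OF fin subgroups_Inter_pair[OF ZC_sub D_sub] t(1)]
    by (simp add: card_derived_center)
qed

lemma card_ZC:
  shows "card ZC = p * card Z \<or> card ZC = p ^ 2 * card Z"
    and "ZC = C \<Longrightarrow> card ZC = p ^ 2 * card Z"
proof -
  obtain t where t: "t \<in> carrier G" "t \<notin> C" using ex_not_in_C by blast
  let ?I = "(\<lambda>h. commutator G h t) ` ZC"
  have card: "card ZC = card Z * card ?I"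
    using card_eq_card_centralizer_mult_card_commutators[OF fin ZC_sub t(1)] ZC_Int_centralizer[OF t] by simp
  show "card ZC = p ^ 2 * card Z" if "ZC = C"
    using card commutators_centralizer[OF t] card_derived that by simp
  have AI: "A \<subseteq> ?I" unfolding commutators_derived[OF t, symmetric] using derived_subset_ZC by blast
  have sub: "subgroup ?I G" using commutators_centralizer_subgroup[OF t ZC_sub] by blast
  have IK: "?I \<subseteq> K" using commutators_centralizer[OF t] by blast
  show "card ZC = p * card Z \<or> card ZC = p ^ 2 * card Z"
  proof (cases "?I = A")
    case True
    then show ?thesis using card card_derived_center by simp
  next
    case False
    then obtain k where "k \<in> ?I" "k \<notin> A" using AI by blast
    then have "?I = K" using derived_subset_if[OF sub AI] IK by blast
    then show ?thesis using card card_derived by simp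
  qed
qed

section \<open>Orders of centralizers and the commutativity degree\<close>

lemma card_centralizer:
  assumes x: "x \<in> carrier G"
  shows "p ^ 2 * card (centralizer G {x}) = order G * (if x \<in> Z then p ^ 2 else if x \<in> ZC \<union> D then p else 1)"
proof -
  have carr: "carrier G \<inter> centralizer G {x} = centralizer G {x}" by (auto simp: centralizer_def)
  consider (center) "x \<in> Z" | (D) "x \<in> D" "x \<notin> Z" | (ZC) "x \<in> ZC" "x \<notin> D"
    | (C) "x \<in> C" "x \<notin> ZC" "x \<notin> D" | (out) "x \<notin> C" by blast
  then show ?thesis
  proof cases
    case center
    then have "centralizer G {x} = carrier G" by (auto simp: centralizer_def group_center_def)
    then show ?thesis using center by (simp add: order_def)
  next
    case D
    obtain g where g: "g \<in> carrier G" "g \<otimes> x \<noteq> x \<otimes> g" using D x by (fastforce simp: group_center_def)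
    have "commutator G h x \<in> A" if "h \<in> carrier G" for h
      using D that commutator_in_sym[OF A_sub x that] by (simp add: center_mod_def)
    then have "card (carrier G) = p * card (carrier G \<inter> centralizer G {x})"
      using g x by (intro card_eq_if_commutators_in_A[of _ _ g] subgroup_self)
    then show ?thesis using D carr by (simp add: order_def power2_eq_square)
  next
    case ZC
    have "x \<notin> Z" using ZC Z_subset by blast
    have "C \<subseteq> centralizer G {x}" using ZC by (auto simp: centralizer_def)
    moreover obtain g where "g \<in> carrier G" "g \<otimes> x \<noteq> x \<otimes> g"
      using \<open>x \<notin> Z\<close> x by (fastforce simp: group_center_def)
    then have "centralizer G {x} \<noteq> carrier G"
      using in_centralizer_singleton[OF x] by blast
    ultimately have "centralizer G {x} = C"
      using subgroup_eq_carrier[OF centralizer_singleton_subgroup[OF x]] by blast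
    then show ?thesis using ZC \<open>x \<notin> Z\<close> card_carrier by (simp add: order_def power2_eq_square)
  next
    case C
    \<comment> \<open>An element outside \<open>C\<close> that commutes with \<open>x\<close> would put \<open>x\<close> into \<open>D\<close>.\<close>
    have "centralizer G {x} \<subseteq> C"
    proof
      fix g assume g: "g \<in> centralizer G {x}"
      then have "commutator G x g = \<one>" using x by (auto simp: centralizer_def commutator_eq_one_iff)
      then show "g \<in> C" using in_D_if[OF C(1), of g] C g one_in_A by (auto simp: centralizer_def)
    qed
    then have "C \<inter> centralizer G {x} = centralizer G {x}" by blast
    moreover have "x \<notin> centralizer G C" using C by blast
    then obtain u where "u \<in> C" "u \<otimes> x \<noteq> x \<otimes> u"
      using x unfolding centralizer_def[of G C] by (smt (verit) mem_Collect_eq)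
    then have "card C = p * card (C \<inter> centralizer G {x})"
      using commutator_centralizer_in_center[OF _ C(1)] by (intro card_eq_if_commutators_in_A[OF C_sub x, of u])
    moreover have "x \<notin> Z" using C Z_subset by blast
    ultimately show ?thesis using C card_carrier by (simp add: order_def power2_eq_square)
  next
    case out
    then have "x \<notin> Z" "x \<notin> ZC \<union> D" using Z_subset D_subset_C by blast+
    then show ?thesis using centralizer_outside[OF x out] by (simp only: if_False mult_1_right)
  qed
qed

lemma finite_members: "finite Z" "finite D" "finite ZC" "finite C"
  using fin finite_subset[OF _ fin] C_carrier by (auto simp: group_center_def center_mod_def centralizer_def)

lemma card_union: "card (ZC \<union> D) + p * card Z = card ZC + card D"
  using card_Un_Int[OF finite_members(3,2)] card_ZC_Int_D by simp

text \<open>By \<open>card_union\<close> the order of \<open>Z\<close> drops out of the sum of the orders of the centralizers.\<close>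

lemma card_commuting:
  "real p ^ 2 * real (card {(x, y). x \<in> carrier G \<and> y \<in> carrier G \<and> x \<otimes> y = y \<otimes> x})
    = real (order G) * (real (order G) + (real p - 1) * (real (card ZC) + real (card D)))"
proof -
  have sub: "Z \<subseteq> carrier G" "ZC \<union> D \<subseteq> carrier G" "Z \<subseteq> ZC \<union> D"
    using C_carrier Z_subset by (auto simp: group_center_def center_mod_def)
  have indicator: "(\<Sum>x\<in>carrier G. if x \<in> W then c else 0) = real (card W) * c"
    if "W \<subseteq> carrier G" for W and c :: real
    using that fin by (simp flip: sum.inter_restrict add: Int_absorb1)
  have "{(x, y). x \<in> carrier G \<and> y \<in> carrier G \<and> x \<otimes> y = y \<otimes> x}
      = (SIGMA x:carrier G. centralizer G {x})"
    by (auto simp: centralizer_def)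
  moreover have "finite (centralizer G {x})" for x
    using fin by (auto simp: centralizer_def)
  ultimately have "real p ^ 2 * real (card {(x, y). x \<in> carrier G \<and> y \<in> carrier G \<and> x \<otimes> y = y \<otimes> x})
      = (\<Sum>x\<in>carrier G. real (p ^ 2 * card (centralizer G {x})))"
    using fin by (simp add: sum_distrib_left)
  also have "\<dots> = (\<Sum>x\<in>carrier G. real (order G) *
      (1 + (if x \<in> ZC \<union> D then real p - 1 else 0) + (if x \<in> Z then real p ^ 2 - real p else 0)))"
  \<comment> \<open>As \<open>Z \<subseteq> ZC \<union> D\<close>, the weights \<open>1\<close>, \<open>p\<close>, \<open>p\<^sup>2\<close> split into sums of indicator functions.\<close>
  proof (rule sum.cong[OF refl])
    fix x assume "x \<in> carrier G"
    then show "real (p ^ 2 * card (centralizer G {x})) = real (order G) *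
      (1 + (if x \<in> ZC \<union> D then real p - 1 else 0) + (if x \<in> Z then real p ^ 2 - real p else 0))"
      using sub(3) unfolding card_centralizer[OF \<open>x \<in> carrier G\<close>] by auto
  qed
  also have "\<dots> = real (order G) * (real (order G) + real (card (ZC \<union> D)) * (real p - 1)
      + real (card Z) * (real p ^ 2 - real p))"
    unfolding sum_distrib_left[symmetric] sum.distrib indicator[OF sub(1)] indicator[OF sub(2)]
    by (simp add: order_def)
  also have "\<dots> = real (order G) * (real (order G) + (real p - 1) * (real (card (ZC \<union> D) + p * card Z)))"
    by (simp add: algebra_simps power2_eq_square)
  finally show ?thesis unfolding card_union by simp
qed

lemma commuting_prob_eq:
  assumes s: "card C = p ^ (2 * s) * card ZC"
  shows "commuting_prob G
    = 1 / real p ^ 4 * ((real p - 1) / real p powi (2 * int s - 1) + real p ^ 2 + real p - 1)"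
proof -
  define n where "n = real (order G)"
  define q where "q = real p"
  have q: "q > 1" using p_gt_1 by (simp add: q_def)
  have n: "n > 0" using fin by (simp add: n_def order_gt_0_iff_finite)
  have C: "n = q * real (card C)" using card_carrier by (simp add: n_def q_def order_def)
  have ZC: "real (card ZC) = n / (q ^ (2 * s) * q)"
    using C s q by (simp add: q_def)
  have D: "real (card D) = n / q ^ 2"
    using C card_C q by (auto simp: q_def power2_eq_square)
  have powi: "q powi (2 * int s - 1) = q ^ (2 * s) / q"
    using q power_int_diff[of q "int (2 * s)" 1] power_int_of_nat[of q "2 * s"] by simp
  define T where "T = real (card {(x, y). x \<in> carrier G \<and> y \<in> carrier G \<and> x \<otimes> y = y \<otimes> x})"
  have "q ^ 2 * T = n * (n + (q - 1) * (n / (q ^ (2 * s) * q) + n / q ^ 2))"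
    using card_commuting unfolding ZC D by (simp add: T_def q_def n_def)
  then have "T / n ^ 2 = (1 + (q - 1) * (1 / (q ^ (2 * s) * q) + 1 / q ^ 2)) / q ^ 2"
    using q n by (simp add: field_simps power2_eq_square)
  also have "\<dots> = 1 / q ^ 4 * ((q - 1) / (q ^ (2 * s) / q) + q ^ 2 + q - 1)"
    using q by (simp add: field_simps power2_eq_square power4_eq_xxxx)
  finally show ?thesis unfolding powi[symmetric] by (simp add: commuting_prob_def T_def n_def q_def)
qed

section \<open>Central quotients and the centre of the centralizer\<close>

text \<open>All commutators lie in \<open>K\<close>, so being central modulo \<open>Z\<close> and modulo \<open>A = K \<inter> Z\<close> is the same.\<close>

lemma center_mod_center_eq: "center_mod G Z = D"
  using commutator_in_derived by (auto simp: center_mod_def)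

lemma index_centers:
  "subgroup_index (G Mod A) (group_center (G Mod A)) = p ^ 2"
  "subgroup_index (G Mod Z) (group_center (G Mod Z)) = p ^ 2"
proof -
  have "card D > 0" using finite_members(2) subgroup.one_closed[OF D_sub] by (auto simp: card_gt_0_iff)
  moreover have "order G = p ^ 2 * card D"
    using card_carrier card_C by (auto simp: order_def power2_eq_square)
  ultimately show "subgroup_index (G Mod A) (group_center (G Mod A)) = p ^ 2"
    "subgroup_index (G Mod Z) (group_center (G Mod Z)) = p ^ 2"
    using index_center_FactGroup[OF fin A_normal] index_center_FactGroup[OF fin group_center_normal]
    unfolding center_mod_center_eq by auto
qed

lemma group_center_C: "group_center (commutator_centralizer G) = ZC"
  by (auto simp: commutator_centralizer_def group_center_def centralizer_def)

lemma index_center_C: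
  "subgroup_index (commutator_centralizer G) (group_center (commutator_centralizer G)) * card ZC = card C"
proof -
  interpret C: group "commutator_centralizer G" by (rule commutator_centralizer_group)
  show ?thesis
    using C.lagrange[OF C.group_center_subgroup] unfolding group_center_C
    by (simp add: subgroup_index_def commutator_centralizer_def order_def)
qed

lemma comm_group_C_iff: "comm_group (commutator_centralizer G) \<longleftrightarrow> ZC = C"
proof -
  interpret C: group "commutator_centralizer G" by (rule commutator_centralizer_group)
  have "comm_group (commutator_centralizer G) \<longleftrightarrow> (\<forall>x\<in>C. \<forall>y\<in>C. x \<otimes> y = y \<otimes> x)"
  proof
    assume "comm_group (commutator_centralizer G)"
    then interpret CC: comm_group "commutator_centralizer G" .
    show "\<forall>x\<in>C. \<forall>y\<in>C. x \<otimes> y = y \<otimes> x"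
      using CC.m_comm by (auto simp: commutator_centralizer_def)
  next
    assume "\<forall>x\<in>C. \<forall>y\<in>C. x \<otimes> y = y \<otimes> x"
    then show "comm_group (commutator_centralizer G)"
      by (intro C.group_comm_groupI) (auto simp: commutator_centralizer_def)
  qed
  also have "\<dots> \<longleftrightarrow> ZC = C" using C_carrier by (auto simp: centralizer_def[of G C])
  finally show ?thesis .
qed

lemma ex_card_C: "\<exists>s. card C = p ^ (2 * s) * card ZC"
proof -
  have "\<exists>s. card C = card A ^ (2 * s) * card ZC"
  proof (rule index_center_even_power[OF fin A_sub _ C_sub])
    show "Factorial_Ring.prime (card A)" using p card_derived_center by simp
    show "x \<otimes> a = a \<otimes> x" if "x \<in> C" "a \<in> A" for x a using A_central that C_carrier by blast
  qed (rule commutator_centralizer_in_center)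
  then show ?thesis by (simp add: card_derived_center)
qed

lemma order_Mod_center: "order (G Mod Z) * card Z = order G"
  using lagrange[OF group_center_subgroup] by (simp add: order_def FactGroup_def)

lemma indices_and_commuting_prob:
  obtains s where
    "subgroup_index (commutator_centralizer G) (group_center (commutator_centralizer G)) = p ^ (2 * s)"
    "commuting_prob G
      = 1 / real p ^ 4 * ((real p - 1) / real p powi (2 * int s - 1) + real p ^ 2 + real p - 1)"
    "comm_group (commutator_centralizer G) \<Longrightarrow> s = 0"
    "comm_group (commutator_centralizer G) \<Longrightarrow> order (G Mod Z) = p ^ 3"
    "order (G Mod Z) \<in> {p ^ (2 * s + 2), p ^ (2 * s + 3)}"
proof -
  obtain s where s: "card C = p ^ (2 * s) * card ZC" using ex_card_C by blast
  have ZC0: "card ZC > 0" using finite_members(3) subgroup.one_closed[OF ZC_sub] by (auto simp: card_gt_0_iff)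
  have Z0: "card Z > 0"
    using finite_members(1) subgroup.one_closed[OF group_center_subgroup] by (auto simp: card_gt_0_iff)
  have order: "order G = p ^ (2 * s + 1) * card ZC"
    using s card_carrier by (simp add: order_def)
  have s0: "s = 0" if "ZC = C"
  proof -
    have "p ^ (2 * s) = p ^ 0" using s ZC0 unfolding that by simp
    then show ?thesis using power_inject_exp[OF p_gt_1, of "2 * s" 0] by simp
  qed
  show thesis
  proof
    show "subgroup_index (commutator_centralizer G) (group_center (commutator_centralizer G)) = p ^ (2 * s)"
      using index_center_C s ZC0 by simp
    show "s = 0" if "comm_group (commutator_centralizer G)" using that s0 comm_group_C_iff by blast
    show "order (G Mod Z) = p ^ 3" if "comm_group (commutator_centralizer G)"
    proof -
      have "ZC = C" "s = 0" using that s0 comm_group_C_iff by blast+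
      then have "order (G Mod Z) * card Z = p * (p ^ 2 * card Z)"
        using card_ZC(2) order order_Mod_center by simp
      also have "\<dots> = p ^ 3 * card Z" by (simp add: power2_eq_square power3_eq_cube)
      finally have "order (G Mod Z) * card Z = p ^ 3 * card Z" .
      then show ?thesis using Z0 by simp
    qed
    have "order (G Mod Z) * card Z = p ^ (2 * s + 2) * card Z \<or>
        order (G Mod Z) * card Z = p ^ (2 * s + 3) * card Z"
      using card_ZC(1) unfolding order_Mod_center order
      by (elim disjE) (simp_all only: power_add power_one_right power2_eq_square power3_eq_cube ac_simps simp_thms)
    then show "order (G Mod Z) \<in> {p ^ (2 * s + 2), p ^ (2 * s + 3)}" using Z0 by simp
  qed (rule commuting_prob_eq[OF s])
qed

end

theorem theorem2p2p6:
  fixes G :: "('a, 'b) monoid_scheme" and p :: nat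
  assumes "group G"
    and "finite (carrier G)"
    and "Factorial_Ring.prime p"
    and "coprime (p - 1) (order G)"
    and "card (derived G (carrier G)) = p ^ 2"
    and "card (derived G (carrier G) \<inter> group_center G) = p"
  shows
    "(\<exists>s::nat.
        subgroup_index (commutator_centralizer G) (group_center (commutator_centralizer G))
          = p ^ (2 * s) \<and>
        (comm_group (commutator_centralizer G) \<longrightarrow>
           commuting_prob G = (2 * real p ^ 2 - 1) / real p ^ 4) \<and>
        (\<not> comm_group (commutator_centralizer G) \<longrightarrow>
           commuting_prob G =
             1 / real p ^ 4 *
               ((real p - 1) / real p powi (2 * int s - 1) + real p ^ 2 + real p - 1)) \<and>
        (comm_group (commutator_centralizer G) \<longrightarrow>
           order (G Mod group_center G) = p ^ 3) \<and>
        (\<not> comm_group (commutator_centralizer G) \<longrightarrow>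
           order (G Mod group_center G) \<in> {p ^ (2 * s + 2), p ^ (2 * s + 3)})) \<and>
     subgroup_index (G Mod (derived G (carrier G) \<inter> group_center G))
         (group_center (G Mod (derived G (carrier G) \<inter> group_center G))) = p ^ 2 \<and>
     subgroup_index (G Mod group_center G) (group_center (G Mod group_center G)) = p ^ 2"
proof -
  interpret derived_prime_square G p
    using assms by (simp add: derived_prime_square_def derived_prime_square_axioms_def)
  obtain s where s:
    "subgroup_index (commutator_centralizer G) (group_center (commutator_centralizer G)) = p ^ (2 * s)"
    "commuting_prob G
      = 1 / real p ^ 4 * ((real p - 1) / real p powi (2 * int s - 1) + real p ^ 2 + real p - 1)"
    "comm_group (commutator_centralizer G) \<Longrightarrow> s = 0"
    "comm_group (commutator_centralizer G) \<Longrightarrow> order (G Mod group_center G) = p ^ 3"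
    "order (G Mod group_center G) \<in> {p ^ (2 * s + 2), p ^ (2 * s + 3)}"
    by (rule indices_and_commuting_prob) (rule that)
  \<comment> \<open>For \<open>s = 0\<close> the divisor \<open>p\<^sup>2\<^sup>s\<^sup>-\<^sup>1\<close> is \<open>1/p\<close>, and the general formula turns into the one for abelian \<open>C\<close>.\<close>
  have ab: "commuting_prob G = (2 * real p ^ 2 - 1) / real p ^ 4"
    if "comm_group (commutator_centralizer G)"
    unfolding s(2) s(3)[OF that] using p_gt_1
    by (simp add: field_simps power2_eq_square power_int_minus)
  show ?thesis
    by (intro exI[of _ s] conjI impI s ab index_centers)
qed

end
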